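(* Let $a_1,b_1,a_2,b_2,a_3,b_3$ be real numbers satisfying condition $(\Omega)$ (defined in the context). Let $i\in\{2,3\}$, and for a branching point $c_i\in[a_i,b_i]$ of the variable $x_i$ let $T_i(c_i)$ be the total volume of the convex-hull relaxations of the two children after branching on $x_i$ at $c_i$ (defined in the context). Then the least total volume is obtained when $c_i=(a_i+b_i)/2$, i.e. $$T_i\Big(\frac{a_i+b_i}{2}\Big)=\min_{c_i\in[a_i,b_i]}T_i(c_i).$$
   Context: Condition $(\Omega)$ on real numbers $a_1,b_1,a_2,b_2,a_3,b_3$: $0\le a_i<b_i$ for $i=1,2,3$, and $a_1b_2b_3+b_1a_2a_3\le b_1a_2b_3+a_1b_2a_3\le b_1b_2a_3+a_1a_2b_3$ (equivalently, $\frac{a_1}{b_1}\le\frac{a_2}{b_2}\le\frac{a_3}{b_3}$). For a box $B=[l_1,u_1]\times[l_2,u_2]\times[l_3,u_3]\subset\mathbb{R}^3$ with $0\le l_i\le u_i$, let $\mathcal{P}_h(B)=\operatorname{conv}\{(f,x_1,x_2,x_3)\in\mathbb{R}^4: f=x_1x_2x_3,\ (x_1,x_2,x_3)\in B\}$ (the convex-hull relaxation of the trilinear monomial $x_1x_2x_3$ on $B$), and let $\operatorname{vol}$ denote $4$-dimensional Lebesgue measure. Let $B_0=[a_1,b_1]\times[a_2,b_2]\times[a_3,b_3]$. For $c_i\in[a_i,b_i]$, the total volume after branching on $x_i$ at $c_i$ is $$T_i(c_i)=\operatorname{vol}\big(\mathcal{P}_h(B_0\cap\{x_i\le c_i\})\big)+\operatorname{vol}\big(\mathcal{P}_h(B_0\cap\{x_i\ge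 c_i\})\big).$$ *)

theory Defs
  imports "HOL-Analysis.Analysis"
begin

text \<open>As \<open>a\<^sub>i < b\<^sub>i\<close>, the two inequalities between sums of products amount to
  \<open>a\<^sub>1/b\<^sub>1 \<le> a\<^sub>2/b\<^sub>2 \<le> a\<^sub>3/b\<^sub>3\<close>: the first is \<open>(a\<^sub>1b\<^sub>2 - b\<^sub>1a\<^sub>2)(b\<^sub>3 - a\<^sub>3) \<le> 0\<close>,
  the second \<open>(a\<^sub>2b\<^sub>3 - b\<^sub>2a\<^sub>3)(b\<^sub>1 - a\<^sub>1) \<le> 0\<close>.\<close>

definition Omega :: "real^3 \<Rightarrow> real^3 \<Rightarrow> bool" where
  "Omega a b \<longleftrightarrow>
     (\<forall>i. 0 \<le> a $ i \<and> a $ i < b $ i) \<and>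
     a$1 * b$2 * b$3 + b$1 * a$2 * a$3 \<le> b$1 * a$2 * b$3 + a$1 * b$2 * a$3 \<and>
     b$1 * a$2 * b$3 + a$1 * b$2 * a$3 \<le> b$1 * b$2 * a$3 + a$1 * a$2 * b$3"

lemma vector_4 [simp]:
  "(vector [w, x, y, z] :: 'a::zero^4) $ 1 = w"
  "(vector [w, x, y, z] :: 'a::zero^4) $ 2 = x"
  "(vector [w, x, y, z] :: 'a::zero^4) $ 3 = y"
  "(vector [w, x, y, z] :: 'a::zero^4) $ 4 = z"
  unfolding vector_def by simp_all

text \<open>Points \<open>(f, x\<^sub>1, x\<^sub>2, x\<^sub>3)\<close> are vectors in \<open>real^4\<close> with \<open>f\<close> as first component.\<close>

definition hull_relaxation :: "(real^3) set \<Rightarrow> (real^4) set" where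
  "hull_relaxation B =
     convex hull {vector [f, x$1, x$2, x$3] | f x. f = x$1 * x$2 * x$3 \<and> x \<in> B}"

definition total_volume :: "real^3 \<Rightarrow> real^3 \<Rightarrow> 3 \<Rightarrow> real \<Rightarrow> real" where
  "total_volume a b i c =
     measure lebesgue (hull_relaxation (cbox a b \<inter> {x. x $ i \<le> c})) +
     measure lebesgue (hull_relaxation (cbox a b \<inter> {x. x $ i \<ge> c}))"

end

theory Submission
  imports Defs
begin

text \<open>
  Write \<open>V(l, u)\<close> for the volume of the relaxation when the interval of \<open>x\<^sub>i\<close> is \<open>[l, u]\<close> and the
  other two intervals are kept. The proof rests on the fact that
  \<open>V(l, u) = (u - l) (Q l + P u)\<close> with constants \<open>P\<close> and \<open>Q\<close>, for all
  \<open>a\<^sub>i \<le> l \<le> u \<le> b\<^sub>i\<close> (\<open>measure_hull_relaxation_slab\<close>). Then the total volume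
  \<open>T(c) = V(a\<^sub>i, c) + V(c, b\<^sub>i)\<close> equals \<open>V(a\<^sub>i, b\<^sub>i) + (P - Q) (c - a\<^sub>i) (c - b\<^sub>i)\<close>, a quadratic
  polynomial that is symmetric about the midpoint, and only \<open>P \<ge> Q\<close> remains to be seen. This needs
  no computation: the relaxations of the children lie in that of the parent and overlap in a null
  set (\<open>total_volume_le\<close>), so \<open>T(c) \<le> V(a\<^sub>i, b\<^sub>i)\<close>, while \<open>(c - a\<^sub>i) (c - b\<^sub>i) < 0\<close> for interior \<open>c\<close>.

  For the formula, map the unit cube to the box by \<open>x\<^sub>j = a\<^sub>j + (b\<^sub>j - a\<^sub>j) t\<^sub>j\<close>. If \<open>a\<^sub>1/b\<^sub>1\<close> is the
  least of the three ratios, the convex and the concave envelope of the monomial interpolate its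
  vertex values on two triangulations of the cube that do not depend on the box, and the relaxation
  is the region between their graphs (\<open>hull_relaxation_eq_envelope_region\<close>). So its volume is the
  product of the three side lengths and the integral of the gap between the envelopes over the
  cube (\<open>measure_hull_relaxation\<close>). The gap is linear in the vertex values, hence linear in \<open>(l, u)\<close>
  (\<open>mean_gap_linear\<close>), and so is its integral, whose value is never computed. The restriction to
  \<open>i \<noteq> 1\<close> matters because a shorter interval has a larger ratio: branching on \<open>x\<^sub>2\<close> or \<open>x\<^sub>3\<close> leaves
  the first ratio the least.
\<close>

section \<open>The region between two graphs in four dimensions\<close>

definition point4 :: "real \<Rightarrow> real^3 \<Rightarrow> real^4" where
  "point4 f x = vector [f, x$1, x$2, x$3]"

lemma point4_nth [simp]:
  "point4 f x $ 1 = f" "point4 f x $ 2 = x$1" "point4 f x $ 3 = x$2" "point4 f x $ 4 = x$3"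
  by (simp_all add: point4_def)

lemma point4_eq_iff [simp]: "point4 f x = point4 g y \<longleftrightarrow> f = g \<and> x = y"
  by (auto simp: vec_eq_iff forall_3 forall_4)

lemma linear_point4: "linear (\<lambda>(f, x). point4 f x)"
  by (rule linearI) (auto simp: vec_eq_iff forall_4)

lemma point4_combination:
  "r *\<^sub>R point4 f x + s *\<^sub>R point4 g y = point4 (r * f + s * g) (r *\<^sub>R x + s *\<^sub>R y)"
  by (simp add: vec_eq_iff forall_4)

lemma prod_Basis_cart:
  fixes v :: "real^'n"
  shows "(\<Prod>b\<in>Basis. v \<bullet> b) = (\<Prod>i\<in>UNIV. v $ i)"
proof -
  have "inj (\<lambda>i::'n. axis i (1::real))"
    by (auto simp: inj_on_def axis_eq_axis)
  moreover have "(Basis :: (real^'n) set) = range (\<lambda>i. axis i 1)"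
    by (auto simp: Basis_vec_def)
  ultimately show ?thesis
    by (metis (no_types, lifting) prod.reindex_cong cart_eq_inner_axis)
qed

text \<open>Fubini's theorem is stated for products of measure spaces, so Lebesgue measure on
  \<open>real \<times> real^3\<close> has to be identified with the one on \<open>real^4\<close>. Both give each open box its volume.\<close>

lemma lborel_point4:
  "distr lborel borel (\<lambda>(f, x). point4 f x) = (lborel :: (real^4) measure)"
proof (rule lborel_eqI[symmetric])
  let ?\<phi> = "\<lambda>(f, x). point4 f x"
  have meas: "?\<phi> \<in> borel_measurable borel"
    by (intro borel_measurable_continuous_onI linear_continuous_on linear_conv_bounded_linear[THEN iffD1]
        linear_point4)
  fix l u :: "real^4"
  assume "\<And>b. b \<in> Basis \<Longrightarrow> l \<bullet> b \<le> u \<bullet> b"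
  then have le: "l $ i \<le> u $ i" for i
    by (metis axis_in_Basis_iff cart_eq_inner_axis Basis_real_def singletonI)
  define l3 u3 :: "real^3" where "l3 = vector [l$2, l$3, l$4]" and "u3 = vector [u$2, u$3, u$4]"
  have vim: "?\<phi> -` box l u = box (l$1) (u$1) \<times> box l3 u3"
    by (auto simp: mem_box_cart forall_3 forall_4 l3_def u3_def)
  have le3: "l3 $ i \<le> u3 $ i" for i
    using le exhaust_3[of i] by (auto simp: l3_def u3_def)
  have "emeasure (distr lborel borel ?\<phi>) (box l u)
      = emeasure (lborel \<Otimes>\<^sub>M lborel) (box (l$1) (u$1) \<times> box l3 u3)"
    by (subst emeasure_distr) (use meas in \<open>auto simp: vim lborel_prod\<close>)
  also have "\<dots> = emeasure lborel (box (l$1) (u$1)) * emeasure lborel (box l3 u3)"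
    by (intro lborel.emeasure_pair_measure_Times) auto
  also have "emeasure lborel (box l3 u3) = ennreal (\<Prod>b\<in>Basis. (u3 - l3) \<bullet> b)"
    by (rule emeasure_lborel_box) (use le3 in \<open>auto simp: Basis_vec_def inner_axis\<close>)
  also have "emeasure lborel (box (l$1) (u$1)) = ennreal (u$1 - l$1)"
    using le[of 1] by simp
  finally have "emeasure (distr lborel borel ?\<phi>) (box l u)
      = ennreal ((u$1 - l$1) * ((u$2 - l$2) * ((u$3 - l$3) * (u$4 - l$4))))"
    using le[of 1] unfolding prod_Basis_cart UNIV_3
    by (simp add: l3_def u3_def ennreal_mult')
  then show "emeasure (distr lborel borel ?\<phi>) (box l u) = (\<Prod>b\<in>Basis. (u - l) \<bullet> b)"
    unfolding prod_Basis_cart UNIV_4 by simp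
qed simp

text \<open>Fubini's theorem, integrating over the first coordinate inside; the vertical section over
  \<open>x \<in> K\<close> is the interval \<open>[p x, q x]\<close>. Compactness holds because the set is the image of
  \<open>K \<times> [0, 1]\<close> under \<open>(x, \<theta>) \<mapsto> p x + \<theta> (q x - p x)\<close>; it supplies measurability.\<close>
lemma measure_between_graphs:
  fixes p q :: "real^3 \<Rightarrow> real"
  assumes K: "compact K" and p: "continuous_on K p" and q: "continuous_on K q"
    and le: "\<And>x. x \<in> K \<Longrightarrow> p x \<le> q x"
  defines "R \<equiv> {point4 f x | f x. x \<in> K \<and> p x \<le> f \<and> f \<le> q x}"
  shows "compact R"
    and "measure lebesgue R = (LINT x|lborel. indicator K x *\<^sub>R (q x - p x))"
proof -
  let ?\<phi> = "\<lambda>(f, x). point4 f x"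
  let ?S = "{(f, x). x \<in> K \<and> p x \<le> f \<and> f \<le> q x}"
  have "?S = (\<lambda>(x, \<theta>). (p x + \<theta> * (q x - p x), x)) ` (K \<times> {0..1})"
  proof (intro equalityI subsetI)
    fix z assume "z \<in> ?S"
    then obtain f x where z: "z = (f, x)" "x \<in> K" "p x \<le> f" "f \<le> q x" by auto
    define \<theta> where "\<theta> = (if p x = q x then 0 else (f - p x) / (q x - p x))"
    have "0 \<le> \<theta>" "\<theta> \<le> 1" "p x + \<theta> * (q x - p x) = f"
      using z le[of x] by (auto simp: \<theta>_def divide_simps)
    then show "z \<in> (\<lambda>(x, \<theta>). (p x + \<theta> * (q x - p x), x)) ` (K \<times> {0..1})"
      using z by (intro image_eqI[of _ _ "(x, \<theta>)"]) auto
  next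
    fix z assume "z \<in> (\<lambda>(x, \<theta>). (p x + \<theta> * (q x - p x), x)) ` (K \<times> {0..1})"
    then obtain y where "y \<in> K \<times> {0..1}" "z = (\<lambda>(x, \<theta>). (p x + \<theta> * (q x - p x), x)) y"
      by blast
    moreover obtain x \<theta> where "y = (x, \<theta>)"
      by (cases y)
    ultimately have z: "z = (p x + \<theta> * (q x - p x), x)" "x \<in> K" "0 \<le> \<theta>" "\<theta> \<le> 1"
      by auto
    have "\<theta> * (q x - p x) \<le> 1 * (q x - p x)"
      using z le[of x] by (intro mult_right_mono) auto
    moreover have "0 \<le> \<theta> * (q x - p x)"
      using z le[of x] by simp
    ultimately show "z \<in> ?S" using z by auto
  qed
  moreover have "compact ((\<lambda>(x, \<theta>). (p x + \<theta> * (q x - p x), x)) ` (K \<times> {0..1::real}))"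
    using compact_Times[OF K compact_Icc]
    unfolding case_prod_unfold
    by (intro compact_continuous_image continuous_intros continuous_on_compose2[OF p] continuous_on_compose2[OF q]) auto
  ultimately have S: "compact ?S"
    by (simp only:)
  have cont: "continuous_on A ?\<phi>" for A
    by (intro linear_continuous_on linear_conv_bounded_linear[THEN iffD1] linear_point4)
  have R_eq: "R = ?\<phi> ` ?S"
    by (force simp: R_def)
  show R: "compact R"
    unfolding R_eq by (intro compact_continuous_image S cont)
  have vim: "?\<phi> -` R = ?S"
    by (auto simp: R_def)
  have "emeasure lborel R = emeasure (distr lborel borel ?\<phi>) R"
    by (simp add: lborel_point4)
  also have "\<dots> = emeasure (lborel \<Otimes>\<^sub>M lborel) ?S"
    by (subst emeasure_distr)
      (use R cont in \<open>auto simp: vim lborel_prod borel_measurable_continuous_onI compact_imp_closed\<close>)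
  also have "\<dots> = (\<integral>\<^sup>+x. emeasure lborel ((\<lambda>f. (f, x)) -` ?S) \<partial>lborel)"
    by (rule lborel_pair.emeasure_pair_measure_alt2)
      (simp only: lborel_prod sets_lborel borel_compact[OF S])
  also have "\<dots> = (\<integral>\<^sup>+x. ennreal (indicator K x *\<^sub>R (q x - p x)) \<partial>lborel)"
  proof (rule nn_integral_cong)
    fix x
    have "(\<lambda>f. (f, x)) -` ?S = (if x \<in> K then {p x..q x} else {})" by auto
    then show "emeasure lborel ((\<lambda>f. (f, x)) -` ?S) = ennreal (indicator K x *\<^sub>R (q x - p x))"
      using le by auto
  qed
  also have "\<dots> = ennreal (LINT x|lborel. indicator K x *\<^sub>R (q x - p x))"
    by (intro nn_integral_eq_integral borel_integrable_compact K continuous_on_diff p q)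
      (auto intro!: AE_I2 simp: indicator_def le)
  finally have "emeasure lborel R = ennreal (LINT x|lborel. indicator K x *\<^sub>R (q x - p x))" .
  moreover have "0 \<le> (LINT x|lborel. indicator K x *\<^sub>R (q x - p x))"
    by (intro integral_nonneg_AE AE_I2) (auto simp: indicator_def le)
  moreover have "measure lebesgue R = measure lborel R"
    using R by (simp add: compact_imp_closed)
  ultimately show "measure lebesgue R = (LINT x|lborel. indicator K x *\<^sub>R (q x - p x))"
    by (simp add: measure_def)
qed

section \<open>Candidate envelopes on the unit cube\<close>

definition rescale :: "real^3 \<Rightarrow> real^3 \<Rightarrow> real^3 \<Rightarrow> real^3" where
  "rescale a b t = (\<chi> i. a $ i + (b $ i - a $ i) * t $ i)"

lemma rescale_nth [simp]: "rescale a b t $ i = a $ i + (b $ i - a $ i) * t $ i"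
  by (simp add: rescale_def)

lemma rescale_combination:
  "r + s = 1 \<Longrightarrow> r *\<^sub>R rescale a b t + s *\<^sub>R rescale a b t' = rescale a b (r *\<^sub>R t + s *\<^sub>R t')"
  by (simp add: vec_eq_iff algebra_simps) (metis (no_types) distrib_left mult.commute mult_1)

lemma rescale_unit_cube:
  assumes "\<And>i. a $ i \<le> b $ i"
  shows "rescale a b ` cbox 0 1 = cbox a b"
proof (intro equalityI subsetI)
  fix x assume "x \<in> rescale a b ` cbox 0 1"
  then obtain t where t: "x = rescale a b t" "\<And>i. 0 \<le> t $ i \<and> t $ i \<le> 1"
    by (auto simp: mem_box_cart)
  have "0 \<le> (b $ i - a $ i) * t $ i" "(b $ i - a $ i) * t $ i \<le> b $ i - a $ i" for i
    using t(2)[of i] assms[of i] by (auto intro: mult_left_le)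
  then show "x \<in> cbox a b"
    by (simp add: t(1) mem_box_cart add_increasing2 le_diff_eq add.commute)
next
  fix x assume x: "x \<in> cbox a b"
  define t where "t = (\<chi> i. if a $ i = b $ i then 0 else (x $ i - a $ i) / (b $ i - a $ i))"
  have ab: "a $ i = b $ i \<or> a $ i < b $ i" for i
    using assms[of i] by auto
  have "x = rescale a b t"
    using x ab by (simp add: t_def vec_eq_iff mem_box_cart) (metis antisym)
  moreover have "0 \<le> t $ i \<and> t $ i \<le> 1" for i
    using x ab[of i] by (auto simp: t_def mem_box_cart)
  ultimately show "x \<in> rescale a b ` cbox 0 1"
    by (auto simp: mem_box_cart)
qed

text \<open>The monomial is supermodular on a box in the nonnegative orthant, so its concave envelope is
  the Lovasz extension of its vertex values: the interpolation that is affine on the six simplices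
  of the Kuhn triangulation, each of which is given by one ordering of the coordinates of \<open>t\<close>.
  Expanding the monomial in \<open>t\<close>, this means replacing each product of coordinates by their
  minimum.\<close>

definition upper_envelope :: "real^3 \<Rightarrow> real^3 \<Rightarrow> real^3 \<Rightarrow> real" where
  "upper_envelope a b t = (let d = b - a in
     a$1 * a$2 * a$3 + d$1 * a$2 * a$3 * t$1 + a$1 * d$2 * a$3 * t$2 + a$1 * a$2 * d$3 * t$3
     + d$1 * d$2 * a$3 * min (t$1) (t$2) + d$1 * a$2 * d$3 * min (t$1) (t$3)
     + a$1 * d$2 * d$3 * min (t$2) (t$3) + d$1 * d$2 * d$3 * min (t$1) (min (t$2) (t$3)))"

text \<open>The interpolation of the vertex values on another triangulation of the cube: the corner at
  \<open>(0,0,0)\<close>, the corner at \<open>(1,1,1)\<close>, and four simplices around the diagonal from \<open>(1,0,0)\<close> to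
  \<open>(0,1,1)\<close> of the octahedron that remains. The interpolation bends only across the four planes
  \<open>t\<^sub>1 + t\<^sub>2 = 1\<close>, \<open>t\<^sub>1 + t\<^sub>3 = 1\<close>, \<open>t\<^sub>1 + t\<^sub>2 + t\<^sub>3 = 1\<close> and \<open>t\<^sub>1 + t\<^sub>2 + t\<^sub>3 = 2\<close>, hence the four
  hinge terms. The affine part interpolates at \<open>(1,0,0)\<close>, \<open>(0,1,0)\<close>, \<open>(0,0,1)\<close>, \<open>(0,1,1)\<close>; its
  constant term \<open>m\<close> is therefore not the value at the origin, which the third hinge corrects.\<close>

definition lower_envelope :: "real^3 \<Rightarrow> real^3 \<Rightarrow> real^3 \<Rightarrow> real" where
  "lower_envelope a b t = (let d = b - a; m = a$1 * (a$2 * a$3 - d$2 * d$3) in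
     m + (b$1 * a$2 * a$3 - m) * t$1 + a$1 * d$2 * b$3 * t$2 + a$1 * b$2 * d$3 * t$3
     + d$2 * (b$1 * a$3 - a$1 * b$3) * max 0 (t$1 + t$2 - 1)
     + d$3 * (b$1 * a$2 - a$1 * b$2) * max 0 (t$1 + t$3 - 1)
     + a$1 * d$2 * d$3 * max 0 (1 - (t$1 + t$2 + t$3))
     + b$1 * d$2 * d$3 * max 0 (t$1 + t$2 + t$3 - 2))"

definition scaled_monomial :: "real^3 \<Rightarrow> real^3 \<Rightarrow> real^3 \<Rightarrow> real" where
  "scaled_monomial a b t = rescale a b t $ 1 * rescale a b t $ 2 * rescale a b t $ 3"

definition envelope_region :: "real^3 \<Rightarrow> real^3 \<Rightarrow> (real^4) set" where
  "envelope_region a b =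
     {point4 f (rescale a b t) | f t. t \<in> cbox 0 1 \<and> lower_envelope a b t \<le> f \<and> f \<le> upper_envelope a b t}"

text \<open>Cross-multiplied form of \<open>a\<^sub>1/b\<^sub>1 \<le> a\<^sub>2/b\<^sub>2\<close> and \<open>a\<^sub>1/b\<^sub>1 \<le> a\<^sub>3/b\<^sub>3\<close>. Degenerate boxes are
  admitted, since branching at an end of the interval produces one. Only the first
  ratio is compared with the others: branching on \<open>x\<^sub>2\<close> can reverse the order of the last two.\<close>

definition first_ratio_least :: "real^3 \<Rightarrow> real^3 \<Rightarrow> bool" where
  "first_ratio_least a b \<longleftrightarrow>
     (\<forall>i. 0 \<le> a $ i \<and> a $ i \<le> b $ i) \<and> a$1 * b$2 \<le> b$1 * a$2 \<and> a$1 * b$3 \<le> b$1 * a$3"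

lemma convex_on_max:
  fixes f g :: "'a::real_vector \<Rightarrow> real"
  assumes "convex_on S f" "convex_on S g"
  shows "convex_on S (\<lambda>x. max (f x) (g x))"
proof (rule convex_onI)
  fix u :: real and x y
  assume u: "0 < u" "u < 1" and xy: "x \<in> S" "y \<in> S"
  have "(1 - u) * f x + u * f y \<le> (1 - u) * max (f x) (g x) + u * max (f y) (g y)"
    and "(1 - u) * g x + u * g y \<le> (1 - u) * max (f x) (g x) + u * max (f y) (g y)"
    using u by (auto intro!: add_mono mult_left_mono)
  with convex_onD[OF assms(1), of u x y] convex_onD[OF assms(2), of u x y] u xy
  show "max (f ((1 - u) *\<^sub>R x + u *\<^sub>R y)) (g ((1 - u) *\<^sub>R x + u *\<^sub>R y))
      \<le> (1 - u) * max (f x) (g x) + u * max (f y) (g y)"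
    by simp
qed (use assms convex_on_imp_convex in blast)

lemma concave_on_min:
  fixes f g :: "'a::real_vector \<Rightarrow> real"
  assumes "concave_on S f" "concave_on S g"
  shows "concave_on S (\<lambda>x. min (f x) (g x))"
  using convex_on_max[OF assms[unfolded concave_on_def]]
  unfolding concave_on_def by (simp add: minus_min_eq_max)

lemma convex_on_coordinate: "convex_on UNIV (\<lambda>t::real^'n. c * t $ i)"
  and concave_on_coordinate: "concave_on UNIV (\<lambda>t::real^'n. c * t $ i)"
  and concave_on_coordinate': "concave_on UNIV (\<lambda>t::real^'n. t $ i)"
  by (auto simp: convex_on_def concave_on_def algebra_simps)

lemma upper_envelope_concave:
  assumes "first_ratio_least a b"
  shows "concave_on UNIV (upper_envelope a b)"
proof -
  have nn: "0 \<le> a $ i" "0 \<le> b $ i - a $ i" for i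
    using assms by (auto simp: first_ratio_least_def)
  show ?thesis
    unfolding upper_envelope_def[abs_def] Let_def vector_minus_component
    by (intro concave_on_add concave_on_cmul concave_on_min concave_on_coordinate
        concave_on_coordinate' mult_nonneg_nonneg nn) (simp add: concave_on_const)
qed

text \<open>The ratio condition enters here: it makes the coefficients of the first two hinges
  nonnegative.\<close>

lemma lower_envelope_convex:
  assumes "first_ratio_least a b"
  shows "convex_on UNIV (lower_envelope a b)"
proof -
  have nn: "0 \<le> a $ i" "0 \<le> b $ i" "0 \<le> b $ i - a $ i" for i
    using assms by (auto simp: first_ratio_least_def intro: order_trans)
  have ratio: "0 \<le> b$1 * a$3 - a$1 * b$3" "0 \<le> b$1 * a$2 - a$1 * b$2"
    using assms by (auto simp: first_ratio_least_def)
  have c: "convex_on UNIV (\<lambda>t::real^3. c)" for c :: real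
    by (simp add: convex_on_const)
  have h: "convex_on UNIV (\<lambda>t::real^3. t $ i + t $ j - 1)"
    "convex_on UNIV (\<lambda>t::real^3. 1 - (t $ 1 + t $ 2 + t $ 3))"
    "convex_on UNIV (\<lambda>t::real^3. t $ 1 + t $ 2 + t $ 3 - 2)" for i j
    by (rule convex_onI; simp add: algebra_simps)+
  show ?thesis
    unfolding lower_envelope_def[abs_def] Let_def vector_minus_component
    \<comment> \<open>Addends that are linear in a coordinate must not be split by the scaling rule, because their
      coefficients can be negative; so that rule comes last.\<close>
    by (rule h c convex_on_add convex_on_max convex_on_coordinate nn ratio
        | rule convex_on_cmul mult_nonneg_nonneg)+
qed

text \<open>The monomial is multilinear in \<open>t\<close>, so it is determined by its values at the vertices of the
  cube. Hence it has the same two expansions as the envelopes, with each minimum or hinge replaced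
  by the multilinear function that agrees with it at the vertices: minima by products, the hinges by
  \<open>t\<^sub>1 t\<^sub>2\<close>, \<open>t\<^sub>1 t\<^sub>3\<close>, \<open>(1 - t\<^sub>1) (1 - t\<^sub>2) (1 - t\<^sub>3)\<close> and \<open>t\<^sub>1 t\<^sub>2 t\<^sub>3\<close>. The coefficients of
  the replaced terms are nonnegative, and the comparison can be made term by term.\<close>

lemma envelopes_bound_monomial:
  assumes "first_ratio_least a b" and "t \<in> cbox 0 1"
  shows "lower_envelope a b t \<le> scaled_monomial a b t" and "scaled_monomial a b t \<le> upper_envelope a b t"
proof -
  have nn: "0 \<le> a $ i" "0 \<le> b $ i" "0 \<le> b $ i - a $ i" for i
    using assms(1) by (auto simp: first_ratio_least_def intro: order_trans)
  have ratio: "0 \<le> b$1 * a$3 - a$1 * b$3" "0 \<le> b$1 * a$2 - a$1 * b$2"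
    using assms(1) by (auto simp: first_ratio_least_def)
  have t: "0 \<le> t $ i" "t $ i \<le> 1" for i
    using assms(2) by (auto simp: mem_box_cart)
  have m2: "t $ i * t $ j \<le> min (t $ i) (t $ j)" for i j
    using t by (simp add: mult_left_le mult_left_le_one_le)
  have m3: "t $ 1 * t $ 2 * t $ 3 \<le> min (t $ 1) (min (t $ 2) (t $ 3))"
    using m2[of 1 2] m2[of 2 3] t mult_left_le[of "t $ 3" "t $ 1 * t $ 2"]
      mult_left_le_one_le[of "t$2 * t$3" "t$1"] by (simp add: mult.assoc)
  let ?d = "\<lambda>i. b $ i - a $ i"
  let ?m = "a$1 * (a$2 * a$3 - ?d 2 * ?d 3)"
  have "scaled_monomial a b t = 
     a$1 * a$2 * a$3 + ?d 1 * a$2 * a$3 * t$1 + a$1 * ?d 2 * a$3 * t$2 + a$1 * a$2 * ?d 3 * t$3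
     + ?d 1 * ?d 2 * a$3 * (t$1 * t$2) + ?d 1 * a$2 * ?d 3 * (t$1 * t$3)
     + a$1 * ?d 2 * ?d 3 * (t$2 * t$3) + ?d 1 * ?d 2 * ?d 3 * (t$1 * t$2 * t$3)"
    by (simp add: scaled_monomial_def algebra_simps)
  also have "\<dots> \<le> upper_envelope a b t"
    unfolding upper_envelope_def Let_def vector_minus_component
    by (intro add_mono order_refl mult_left_mono m2 m3 mult_nonneg_nonneg nn)
  finally show "scaled_monomial a b t \<le> upper_envelope a b t" .
  have p2: "max 0 (t $ i + t $ j - 1) \<le> t $ i * t $ j" for i j
  proof -
    have "0 \<le> (1 - t $ i) * (1 - t $ j)" "0 \<le> t $ i * t $ j"
      using t by simp_all
    then show ?thesis by (simp add: algebra_simps)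
  qed
  have corner: "max 0 (x + y + z - 2) \<le> x * y * z"
    if "0 \<le> x" "x \<le> 1" "0 \<le> y" "y \<le> 1" "0 \<le> z" "z \<le> 1" for x y z :: real
  proof -
    have "0 \<le> (1 - x) * (1 - y)" "0 \<le> (1 - x * y) * (1 - z)"
      using that by (simp_all add: mult_le_one)
    then have "x + y + z - 2 \<le> x * y * z" by (simp add: algebra_simps)
    then show ?thesis using that by simp
  qed
  have p0: "max 0 (1 - (t$1 + t$2 + t$3)) \<le> (1 - t$1) * (1 - t$2) * (1 - t$3)"
    using corner[of "1 - t$1" "1 - t$2" "1 - t$3"] t by (simp add: algebra_simps)
  have p3: "max 0 (t$1 + t$2 + t$3 - 2) \<le> t$1 * t$2 * t$3"
    using corner[of "t$1" "t$2" "t$3"] t by simp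
  have "lower_envelope a b t \<le> ?m + (b$1 * a$2 * a$3 - ?m) * t$1 + a$1 * ?d 2 * b$3 * t$2 + a$1 * b$2 * ?d 3 * t$3
     + ?d 2 * (b$1 * a$3 - a$1 * b$3) * (t$1 * t$2)
     + ?d 3 * (b$1 * a$2 - a$1 * b$2) * (t$1 * t$3)
     + a$1 * ?d 2 * ?d 3 * ((1 - t$1) * (1 - t$2) * (1 - t$3))
     + b$1 * ?d 2 * ?d 3 * (t$1 * t$2 * t$3)"
    unfolding lower_envelope_def Let_def vector_minus_component
    by (intro add_mono order_refl mult_left_mono p2 p0 p3 mult_nonneg_nonneg nn ratio)
  also have "\<dots> = scaled_monomial a b t"
    by (simp add: scaled_monomial_def algebra_simps)
  finally show "lower_envelope a b t \<le> scaled_monomial a b t" .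
qed

lemma convex_envelope_region:
  assumes "first_ratio_least a b"
  shows "convex (envelope_region a b)"
proof (rule convexI)
  fix v w :: "real^4" and r s :: real
  assume "v \<in> envelope_region a b" "w \<in> envelope_region a b" and rs: "0 \<le> r" "0 \<le> s" "r + s = 1"
  then obtain f t g t' where v: "v = point4 f (rescale a b t)" "t \<in> cbox 0 1"
      "lower_envelope a b t \<le> f" "f \<le> upper_envelope a b t"
    and w: "w = point4 g (rescale a b t')" "t' \<in> cbox 0 1"
      "lower_envelope a b t' \<le> g" "g \<le> upper_envelope a b t'"
    unfolding envelope_region_def by blast
  let ?T = "r *\<^sub>R t + s *\<^sub>R t'"
  have "lower_envelope a b ?T \<le> r * lower_envelope a b t + s * lower_envelope a b t'"
    using lower_envelope_convex[OF assms] rs unfolding convex_on_def by simp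
  also have "\<dots> \<le> r * f + s * g"
    using v w rs by (intro add_mono mult_left_mono)
  finally have lo: "lower_envelope a b ?T \<le> r * f + s * g" .
  have "r * f + s * g \<le> r * upper_envelope a b t + s * upper_envelope a b t'"
    using v w rs by (intro add_mono mult_left_mono)
  also have "\<dots> \<le> upper_envelope a b ?T"
    using upper_envelope_concave[OF assms] rs unfolding concave_on_iff by simp
  finally have up: "r * f + s * g \<le> upper_envelope a b ?T" .
  have "?T \<in> cbox 0 1"
    using v w rs convex_box(1)[of 0 1] by (auto simp: convex_def)
  with lo up show "r *\<^sub>R v + s *\<^sub>R w \<in> envelope_region a b"
    unfolding v w point4_combination rescale_combination[OF rs(3)] envelope_region_def by blast
qed

section \<open>The relaxation is the region between the envelopes\<close>

lemma hull_relaxation_point4: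
  "hull_relaxation B = convex hull ((\<lambda>x. point4 (x$1 * x$2 * x$3) x) ` B)"
  unfolding hull_relaxation_def point4_def by (rule arg_cong[where f = "\<lambda>S. convex hull S"]) auto

text \<open>A function that is affine on a simplex with vertices on the graph of the monomial has its graph
  over that simplex in the convex hull. Applied to the simplices of the two triangulations, with the
  barycentric coordinates of \<open>t\<close> as weights, this puts the graphs of both envelopes into the
  relaxation.\<close>

lemma simplex_in_hull_relaxation:
  assumes ab: "\<And>i. a $ i \<le> b $ i"
    and e: "e0 \<in> cbox 0 1" "e1 \<in> cbox 0 1" "e2 \<in> cbox 0 1" "e3 \<in> cbox 0 1"
    and w: "0 \<le> w0" "0 \<le> w1" "0 \<le> w2" "0 \<le> w3" "w0 + w1 + w2 + w3 = 1"
    and t: "t = w0 *\<^sub>R e0 + w1 *\<^sub>R e1 + w2 *\<^sub>R e2 + w3 *\<^sub>R e3"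
    and f: "f = w0 * scaled_monomial a b e0 + w1 * scaled_monomial a b e1
              + w2 * scaled_monomial a b e2 + w3 * scaled_monomial a b e3"
  shows "point4 f (rescale a b t) \<in> hull_relaxation (cbox a b)"
proof -
  let ?p = "\<lambda>e. point4 (scaled_monomial a b e) (rescale a b e)"
  let ?G = "(\<lambda>x. point4 (x$1 * x$2 * x$3) x) ` cbox a b"
  have G: "?p e \<in> ?G" if "e \<in> cbox 0 1" for e
    using that rescale_unit_cube[OF ab] unfolding scaled_monomial_def by blast
  \<comment> \<open>The four vertices and weights, indexed for the closure of convex sets under finite sums.\<close>
  define E where "E = (\<lambda>i::nat. if i = 0 then e0 else if i = 1 then e1 else if i = 2 then e2 else e3)"
  define W where "W = (\<lambda>i::nat. if i = 0 then w0 else if i = 1 then w1 else if i = 2 then w2 else w3)"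
  have "(\<Sum>i<4. W i *\<^sub>R ?p (E i)) \<in> convex hull ?G"
    by (intro convex_sum convex_convex_hull hull_inc G)
      (use e w in \<open>auto simp: E_def W_def eval_nat_numeral\<close>)
  also have "(\<Sum>i<4. W i *\<^sub>R ?p (E i)) = point4 f (rescale a b t)"
  proof -
    have w0: "w0 = 1 - w1 - w2 - w3" using w(5) by simp
    show ?thesis
      unfolding t f E_def W_def
      by (simp add: eval_nat_numeral vec_eq_iff forall_4 w0 algebra_simps)
  qed
  finally show ?thesis
    unfolding hull_relaxation_point4 .
qed

lemma vector3_in_unit_cube:
  "(vector [x, y, z] :: real^3) \<in> cbox 0 1 \<longleftrightarrow> x \<in> {0..1} \<and> y \<in> {0..1} \<and> z \<in> {0..1}"
  by (auto simp: mem_box_cart forall_3)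

lemma upper_envelope_in_hull:
  assumes ab: "\<And>i. a $ i \<le> b $ i" and t: "t \<in> cbox 0 1"
  shows "point4 (upper_envelope a b t) (rescale a b t) \<in> hull_relaxation (cbox a b)"
proof -
  have t01: "0 \<le> t $ i" "t $ i \<le> 1" for i
    using t by (auto simp: mem_box_cart)
  note simplex = simplex_in_hull_relaxation[OF ab, where ?e0.0 = "vector [0,0,0]" and ?e3.0 = "vector [1,1,1]"]
  note simps = vector3_in_unit_cube vec_eq_iff forall_3 upper_envelope_def scaled_monomial_def Let_def
    min_absorb1 min_absorb2
  consider "t$1 \<ge> t$2" "t$2 \<ge> t$3" | "t$1 \<ge> t$3" "t$3 \<ge> t$2" | "t$2 \<ge> t$1" "t$1 \<ge> t$3"
    | "t$2 \<ge> t$3" "t$3 \<ge> t$1" | "t$3 \<ge> t$1" "t$1 \<ge> t$2" | "t$3 \<ge> t$2" "t$2 \<ge> t$1"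
    by linarith
  then show ?thesis
  proof cases
    case 1
    then show ?thesis
      by (intro simplex[where ?e1.0 = "vector [1,0,0]" and ?e2.0 = "vector [1,1,0]" and
        ?w0.0 = "1 - t$1" and ?w1.0 = "t$1 - t$2" and ?w2.0 = "t$2 - t$3" and ?w3.0 = "t$3"])
        (use t01 in \<open>simp_all add: simps algebra_simps\<close>)
  next
    case 2
    then show ?thesis
      by (intro simplex[where ?e1.0 = "vector [1,0,0]" and ?e2.0 = "vector [1,0,1]" and
        ?w0.0 = "1 - t$1" and ?w1.0 = "t$1 - t$3" and ?w2.0 = "t$3 - t$2" and ?w3.0 = "t$2"])
        (use t01 in \<open>simp_all add: simps algebra_simps\<close>)
  next
    case 3
    then show ?thesis
      by (intro simplex[where ?e1.0 = "vector [0,1,0]" and ?e2.0 = "vector [1,1,0]" and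
        ?w0.0 = "1 - t$2" and ?w1.0 = "t$2 - t$1" and ?w2.0 = "t$1 - t$3" and ?w3.0 = "t$3"])
        (use t01 in \<open>simp_all add: simps algebra_simps\<close>)
  next
    case 4
    then show ?thesis
      by (intro simplex[where ?e1.0 = "vector [0,1,0]" and ?e2.0 = "vector [0,1,1]" and
        ?w0.0 = "1 - t$2" and ?w1.0 = "t$2 - t$3" and ?w2.0 = "t$3 - t$1" and ?w3.0 = "t$1"])
        (use t01 in \<open>simp_all add: simps algebra_simps\<close>)
  next
    case 5
    then show ?thesis
      by (intro simplex[where ?e1.0 = "vector [0,0,1]" and ?e2.0 = "vector [1,0,1]" and
        ?w0.0 = "1 - t$3" and ?w1.0 = "t$3 - t$1" and ?w2.0 = "t$1 - t$2" and ?w3.0 = "t$2"])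
        (use t01 in \<open>simp_all add: simps algebra_simps\<close>)
  next
    case 6
    then show ?thesis
      by (intro simplex[where ?e1.0 = "vector [0,0,1]" and ?e2.0 = "vector [0,1,1]" and
        ?w0.0 = "1 - t$3" and ?w1.0 = "t$3 - t$2" and ?w2.0 = "t$2 - t$1" and ?w3.0 = "t$1"])
        (use t01 in \<open>simp_all add: simps algebra_simps\<close>)
  qed
qed

lemma lower_envelope_in_hull:
  assumes ab: "\<And>i. a $ i \<le> b $ i" and t: "t \<in> cbox 0 1"
  shows "point4 (lower_envelope a b t) (rescale a b t) \<in> hull_relaxation (cbox a b)"
proof -
  have t01: "0 \<le> t $ i" "t $ i \<le> 1" for i
    using t by (auto simp: mem_box_cart)
  note simplex = simplex_in_hull_relaxation[OF ab]
  note simps = vector3_in_unit_cube vec_eq_iff forall_3 lower_envelope_def scaled_monomial_def Let_def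
    max_absorb1 max_absorb2
  \<comment> \<open>The two corners, then the four simplices around the diagonal. In cases 4 and 5 the inequalities
    \<open>1 \<le> t\<^sub>1 + t\<^sub>2 + t\<^sub>3 \<le> 2\<close> follow from the two that are listed.\<close>
  consider "t$1 + t$2 + t$3 \<le> 1" | "2 \<le> t$1 + t$2 + t$3"
    | "t$1 + t$2 \<le> 1" "t$1 + t$3 \<le> 1" "1 \<le> t$1 + t$2 + t$3"
    | "1 \<le> t$1 + t$2" "t$1 + t$3 \<le> 1"
    | "t$1 + t$2 \<le> 1" "1 \<le> t$1 + t$3"
    | "1 \<le> t$1 + t$2" "1 \<le> t$1 + t$3" "t$1 + t$2 + t$3 \<le> 2"
    by linarith
  then show ?thesis
  proof cases
    case 1
    then show ?thesis
      by (intro simplex[where ?e0.0 = "vector [0,0,0]" and ?w0.0 = "1 - (t$1 + t$2 + t$3)"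
          and ?e1.0 = "vector [1,0,0]" and ?w1.0 = "t$1"
          and ?e2.0 = "vector [0,1,0]" and ?w2.0 = "t$2"
          and ?e3.0 = "vector [0,0,1]" and ?w3.0 = "t$3"])
        (use t01[of 1] t01[of 2] t01[of 3] in \<open>simp_all add: simps algebra_simps\<close>)
  next
    case 2
    then show ?thesis
      by (intro simplex[where ?e0.0 = "vector [1,1,1]" and ?w0.0 = "t$1 + t$2 + t$3 - 2"
          and ?e1.0 = "vector [0,1,1]" and ?w1.0 = "1 - t$1"
          and ?e2.0 = "vector [1,0,1]" and ?w2.0 = "1 - t$2"
          and ?e3.0 = "vector [1,1,0]" and ?w3.0 = "1 - t$3"])
        (use t01[of 1] t01[of 2] t01[of 3] in \<open>simp_all add: simps algebra_simps\<close>)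
  next
    case 3
    then show ?thesis
      by (intro simplex[where ?e0.0 = "vector [0,1,1]" and ?w0.0 = "t$1 + t$2 + t$3 - 1"
          and ?e1.0 = "vector [1,0,0]" and ?w1.0 = "t$1"
          and ?e2.0 = "vector [0,1,0]" and ?w2.0 = "1 - t$1 - t$3"
          and ?e3.0 = "vector [0,0,1]" and ?w3.0 = "1 - t$1 - t$2"])
        (use t01[of 1] t01[of 2] t01[of 3] in \<open>simp_all add: simps algebra_simps\<close>)
  next
    case 4
    then show ?thesis
      by (intro simplex[where ?e0.0 = "vector [0,1,1]" and ?w0.0 = "t$3"
          and ?e1.0 = "vector [1,0,0]" and ?w1.0 = "1 - t$2"
          and ?e2.0 = "vector [0,1,0]" and ?w2.0 = "1 - t$1 - t$3"
          and ?e3.0 = "vector [1,1,0]" and ?w3.0 = "t$1 + t$2 - 1"])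
        (use t01[of 1] t01[of 2] t01[of 3] in \<open>simp_all add: simps algebra_simps\<close>)
  next
    case 5
    then show ?thesis
      by (intro simplex[where ?e0.0 = "vector [0,1,1]" and ?w0.0 = "t$2"
          and ?e1.0 = "vector [1,0,0]" and ?w1.0 = "1 - t$3"
          and ?e2.0 = "vector [0,0,1]" and ?w2.0 = "1 - t$1 - t$2"
          and ?e3.0 = "vector [1,0,1]" and ?w3.0 = "t$1 + t$3 - 1"])
        (use t01[of 1] t01[of 2] t01[of 3] in \<open>simp_all add: simps algebra_simps\<close>)
  next
    case 6
    then show ?thesis
      by (intro simplex[where ?e0.0 = "vector [0,1,1]" and ?w0.0 = "1 - t$1"
          and ?e1.0 = "vector [1,0,0]" and ?w1.0 = "2 - (t$1 + t$2 + t$3)"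
          and ?e2.0 = "vector [1,1,0]" and ?w2.0 = "t$1 + t$2 - 1"
          and ?e3.0 = "vector [1,0,1]" and ?w3.0 = "t$1 + t$3 - 1"])
        (use t01[of 1] t01[of 2] t01[of 3] in \<open>simp_all add: simps algebra_simps\<close>)
  qed
qed

lemma envelopes_le:
  assumes "first_ratio_least a b" and "t \<in> cbox 0 1"
  shows "lower_envelope a b t \<le> upper_envelope a b t"
  using envelopes_bound_monomial[OF assms] by simp

text \<open>One inclusion holds since the region is convex and contains the graph of the monomial, the
  other since the hull contains the graphs of both envelopes and with them the vertical segments
  in between.\<close>

proposition hull_relaxation_eq_envelope_region:
  assumes "first_ratio_least a b"
  shows "hull_relaxation (cbox a b) = envelope_region a b"
proof
  have ab: "a $ i \<le> b $ i" for i
    using assms by (simp add: first_ratio_least_def)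
  show "hull_relaxation (cbox a b) \<subseteq> envelope_region a b"
    unfolding hull_relaxation_point4
  proof (rule hull_minimal)
    show "(\<lambda>x. point4 (x$1 * x$2 * x$3) x) ` cbox a b \<subseteq> envelope_region a b"
      using envelopes_bound_monomial[OF assms]
      unfolding envelope_region_def scaled_monomial_def rescale_unit_cube[OF ab, symmetric] by blast
  qed (rule convex_envelope_region[OF assms])
  show "envelope_region a b \<subseteq> hull_relaxation (cbox a b)"
  proof
    fix v assume "v \<in> envelope_region a b"
    then obtain f t where v: "v = point4 f (rescale a b t)" and t: "t \<in> cbox 0 1"
      and f: "lower_envelope a b t \<le> f" "f \<le> upper_envelope a b t"
      unfolding envelope_region_def by blast
    have "f \<in> closed_segment (lower_envelope a b t) (upper_envelope a b t)"
      using f by (simp add: closed_segment_eq_real_ivl)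
    then obtain u where u: "0 \<le> u" "u \<le> 1" "f = (1 - u) * lower_envelope a b t + u * upper_envelope a b t"
      by (auto simp: in_segment)
    have "v = (1 - u) *\<^sub>R point4 (lower_envelope a b t) (rescale a b t)
        + u *\<^sub>R point4 (upper_envelope a b t) (rescale a b t)"
      unfolding point4_combination by (simp add: v u(3) flip: scaleR_add_left)
    also have "\<dots> \<in> hull_relaxation (cbox a b)"
      using lower_envelope_in_hull[OF ab t] upper_envelope_in_hull[OF ab t] u(1,2)
      unfolding hull_relaxation_def by (intro convexD[OF convex_convex_hull]) auto
    finally show "v \<in> hull_relaxation (cbox a b)" .
  qed
qed

section \<open>The volume as a function of one interval\<close>

definition mean_gap :: "real^3 \<Rightarrow> real^3 \<Rightarrow> real" where
  "mean_gap a b = (LINT t|lborel. indicator (cbox 0 1) t *\<^sub>R (upper_envelope a b t - lower_envelope a b t))"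

lemma continuous_on_envelopes:
  "continuous_on S (upper_envelope a b)" "continuous_on S (lower_envelope a b)"
  unfolding upper_envelope_def[abs_def] lower_envelope_def[abs_def] Let_def
  by (intro continuous_intros)+

text \<open>The relaxation is the image of the region between the envelopes over the unit cube under an
  affine map with a diagonal linear part, and Fubini's theorem gives the volume of that region.\<close>

proposition measure_hull_relaxation:
  assumes "first_ratio_least a b"
  shows "measure lebesgue (hull_relaxation (cbox a b))
       = (b$1 - a$1) * (b$2 - a$2) * (b$3 - a$3) * mean_gap a b"
proof -
  let ?R = "{point4 f t | f t. t \<in> cbox 0 1 \<and> lower_envelope a b t \<le> f \<and> f \<le> upper_envelope a b t}"
  let ?h = "\<lambda>v::real^4. \<chi> k. point4 1 (b - a) $ k * v $ k"
  have R: "compact ?R" "measure lebesgue ?R = mean_gap a b"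
    using measure_between_graphs[OF compact_cbox continuous_on_envelopes(2,1) envelopes_le[OF assms]]
    by (simp_all add: mean_gap_def)
  have lin: "linear ?h"
    by (rule linearI) (simp_all add: vec_eq_iff algebra_simps)
  define A where "A = matrix ?h"
  \<comment> \<open>The diagonal entry for the coordinate \<open>f\<close> is 1, as \<open>f\<close> is not rescaled.\<close>
  have diag: "A $ k $ k = point4 1 (b - a) $ k" for k
    by (simp add: A_def matrix_def axis_def)
  have off: "A $ j $ k = 0" if "j \<noteq> k" for j k
    unfolding A_def matrix_def axis_def using that by simp
  have "det A = (\<Prod>k\<in>UNIV. point4 1 (b - a) $ k)"
    unfolding diag[symmetric] by (rule det_diagonal) (rule off)
  also have "\<dots> = (b$1 - a$1) * (b$2 - a$2) * (b$3 - a$3)"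
    unfolding UNIV_4 by simp
  finally have det: "det (matrix ?h) = (b$1 - a$1) * (b$2 - a$2) * (b$3 - a$3)"
    unfolding A_def .
  have h: "point4 0 a + ?h (point4 f t) = point4 f (rescale a b t)" for f t
    by (simp add: vec_eq_iff forall_4)
  have "envelope_region a b = (\<lambda>v. point4 0 a + ?h v) ` ?R"
    unfolding envelope_region_def h[symmetric] by blast
  then have "envelope_region a b = (+) (point4 0 a) ` ?h ` ?R"
    by (simp only: image_image)
  then have "measure lebesgue (hull_relaxation (cbox a b)) = measure lebesgue (?h ` ?R)"
    using measure_translation by (simp add: hull_relaxation_eq_envelope_region[OF assms])
  also have "\<dots> = \<bar>det (matrix ?h)\<bar> * measure lebesgue ?R"
    by (rule measure_linear_image[OF lin lmeasurable_compact[OF R(1)]])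
  also have "\<bar>det (matrix ?h)\<bar> = (b$1 - a$1) * (b$2 - a$2) * (b$3 - a$3)"
    using assms by (simp add: det first_ratio_least_def)
  finally show ?thesis
    by (simp add: R(2))
qed

definition set_coord :: "real^'n \<Rightarrow> 'n \<Rightarrow> real \<Rightarrow> real^'n" where
  "set_coord a i l = (\<chi> j. if j = i then l else a $ j)"

lemma set_coord_nth [simp]: "set_coord a i l $ j = (if j = i then l else a $ j)"
  by (simp add: set_coord_def)

lemma set_coord_self [simp]: "set_coord a i (a $ i) = a"
  by (simp add: vec_eq_iff)

text \<open>The triangulations do not depend on the box, and the vertex values \<open>x\<^sub>1 x\<^sub>2 x\<^sub>3\<close> are linear
  in the pair of bounds of any one coordinate. So are the envelopes at each point of the cube.
  The values at the bounds \<open>(1, 0)\<close> and \<open>(0, 1)\<close> are only coefficients; \<open>(1, 0)\<close> does not bound an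
  interval.\<close>

lemma gap_linear:
  fixes a b t :: "real^3"
  assumes "i \<in> {2, 3}"
  defines "gap \<equiv> \<lambda>l u. upper_envelope (set_coord a i l) (set_coord b i u) t
                       - lower_envelope (set_coord a i l) (set_coord b i u) t"
  shows "gap l u = l * gap 1 0 + u * gap 0 1"
proof -
  \<comment> \<open>With the minima and hinges named, what remains is a polynomial identity.\<close>
  define M N where "M = (\<lambda>x y. min (t $ x) (t $ y))" and "N = min (t $ 1) (min (t $ 2) (t $ 3))"
  define H1 H2 H3 H4 where "H1 = max 0 (t$1 + t$2 - 1)" and "H2 = max 0 (t$1 + t$3 - 1)"
    and "H3 = max 0 (1 - (t$1 + t$2 + t$3))" and "H4 = max 0 (t$1 + t$2 + t$3 - 2)"
  consider "i = 2" | "i = 3" using assms(1) by auto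
  then show ?thesis
  proof cases
    case 1
    then show ?thesis
      unfolding gap_def upper_envelope_def lower_envelope_def Let_def
        M_def[THEN fun_cong, THEN fun_cong, symmetric] N_def[symmetric]
        H1_def[symmetric] H2_def[symmetric] H3_def[symmetric] H4_def[symmetric]
      by (simp add: algebra_simps)
  next
    case 2
    then show ?thesis
      unfolding gap_def upper_envelope_def lower_envelope_def Let_def
        M_def[THEN fun_cong, THEN fun_cong, symmetric] N_def[symmetric]
        H1_def[symmetric] H2_def[symmetric] H3_def[symmetric] H4_def[symmetric]
      by (simp add: algebra_simps)
  qed
qed

lemma mean_gap_linear:
  fixes a b :: "real^3"
  assumes "i \<in> {2, 3}"
  shows "mean_gap (set_coord a i l) (set_coord b i u)
    = l * mean_gap (set_coord a i 1) (set_coord b i 0) + u * mean_gap (set_coord a i 0) (set_coord b i 1)"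
proof -
  let ?g = "\<lambda>l u t. upper_envelope (set_coord a i l) (set_coord b i u) t
                 - lower_envelope (set_coord a i l) (set_coord b i u) t"
  have int: "integrable lborel (\<lambda>t. indicator (cbox 0 1) t *\<^sub>R ?g l u t)" for l u
    by (intro borel_integrable_compact compact_cbox continuous_on_diff continuous_on_envelopes)
  have "mean_gap (set_coord a i l) (set_coord b i u)
      = (LINT t|lborel. l * (indicator (cbox 0 1) t *\<^sub>R ?g 1 0 t) + u * (indicator (cbox 0 1) t *\<^sub>R ?g 0 1 t))"
    unfolding mean_gap_def gap_linear[OF assms, of a l b u] by (simp add: algebra_simps)
  also have "\<dots> = l * (LINT t|lborel. indicator (cbox 0 1) t *\<^sub>R ?g 1 0 t)
      + u * (LINT t|lborel. indicator (cbox 0 1) t *\<^sub>R ?g 0 1 t)"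
    by (subst Bochner_Integration.integral_add)
      (intro integrable_mult_right int, intro integrable_mult_right int, 
       simp only: integral_mult_right_zero)
  finally show ?thesis
    unfolding mean_gap_def .
qed

text \<open>Replacing \<open>[a\<^sub>i, b\<^sub>i]\<close> by a subinterval can only raise \<open>a\<^sub>i/b\<^sub>i\<close>. As \<open>i \<noteq> 1\<close>, the first ratio
  stays the least one, and one and the same formula holds for the box and all its slabs.\<close>

lemma measure_hull_relaxation_slab:
  fixes a b :: "real^3"
  assumes "Omega a b" and "i \<in> {2, 3}"
  obtains P Q where "\<And>l u. a $ i \<le> l \<Longrightarrow> l \<le> u \<Longrightarrow> u \<le> b $ i \<Longrightarrow>
    measure lebesgue (hull_relaxation (cbox (set_coord a i l) (set_coord b i u))) = (u - l) * (Q * l + P * u)"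
proof -
  have ab: "0 \<le> a $ j" "a $ j < b $ j" for j
    using assms(1) by (auto simp: Omega_def)
  have "(a$1 * b$2 - b$1 * a$2) * (b$3 - a$3) \<le> 0"
    using assms(1) by (simp add: Omega_def algebra_simps)
  then have r2: "a$1 * b$2 \<le> b$1 * a$2"
    using ab(2)[of 3] by (simp add: mult_le_0_iff)
  have "(a$2 * b$3 - b$2 * a$3) * (b$1 - a$1) \<le> 0"
    using assms(1) by (simp add: Omega_def algebra_simps)
  then have r23: "a$2 * b$3 \<le> b$2 * a$3"
    using ab(2)[of 1] by (simp add: mult_le_0_iff)
  have "b$2 * (a$1 * b$3) \<le> b$3 * (b$1 * a$2)"
    using mult_left_mono[OF r2, of "b$3"] ab(1)[of 3] ab(2)[of 3] by (simp add: mult_ac)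
  also have "\<dots> \<le> b$2 * (b$1 * a$3)"
    using mult_left_mono[OF r23, of "b$1"] ab(1)[of 1] ab(2)[of 1] by (simp add: mult_ac)
  finally have r3: "a$1 * b$3 \<le> b$1 * a$3"
    using ab(1)[of 2] ab(2)[of 2] by simp
  have r: "a$1 * b$i \<le> b$1 * a$i"
    using r2 r3 assms(2) by auto
  define D where "D = (b$1 - a$1) * (if i = 2 then b$3 - a$3 else b$2 - a$2)"
  have slab: "measure lebesgue (hull_relaxation (cbox (set_coord a i l) (set_coord b i u)))
      = (u - l) * ((D * mean_gap (set_coord a i 1) (set_coord b i 0)) * l
                 + (D * mean_gap (set_coord a i 0) (set_coord b i 1)) * u)"
    if lu: "a $ i \<le> l" "l \<le> u" "u \<le> b $ i" for l u
  proof -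
    have "a$1 * u \<le> a$1 * b$i" "b$1 * a$i \<le> b$1 * l"
      using lu ab(1)[of 1] ab(2)[of 1] by (auto intro: mult_left_mono)
    with r have "a$1 * u \<le> b$1 * l" by simp
    then have frl: "first_ratio_least (set_coord a i l) (set_coord b i u)"
      using assms(2) ab lu r2 r3 order_trans[OF ab(1) lu(1)]
      unfolding first_ratio_least_def by (auto intro: less_imp_le)
    show ?thesis
      unfolding measure_hull_relaxation[OF frl] mean_gap_linear[OF assms(2), of a l b u]
      using assms(2) by (auto simp: D_def algebra_simps)
  qed
  show thesis
    by (rule that[OF slab])
qed

section \<open>Branching\<close>

lemma cbox_cut:
  fixes a b :: "real^'n"
  assumes "a $ i \<le> c" "c \<le> b $ i"
  shows "cbox a b \<inter> {x. x $ i \<le> c} = cbox a (set_coord b i c)"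
    and "cbox a b \<inter> {x. c \<le> x $ i} = cbox (set_coord a i c) b"
proof -
  have "x $ i \<le> c \<and> (\<forall>j. x $ j \<le> b $ j) \<longleftrightarrow> (\<forall>j. x $ j \<le> set_coord b i c $ j)" for x
  proof safe
    fix j assume le: "\<forall>j. x $ j \<le> set_coord b i c $ j"
    show "x $ i \<le> c" using le[rule_format, of i] by simp
    then show "x $ j \<le> b $ j"
      using le[rule_format, of j] assms(2) by (cases "j = i") auto
  qed simp
  then show "cbox a b \<inter> {x. x $ i \<le> c} = cbox a (set_coord b i c)"
    unfolding set_eq_iff Int_iff mem_Collect_eq mem_box_cart by blast
  have "c \<le> x $ i \<and> (\<forall>j. a $ j \<le> x $ j) \<longleftrightarrow> (\<forall>j. set_coord a i c $ j \<le> x $ j)" for x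
  proof safe
    fix j assume le: "\<forall>j. set_coord a i c $ j \<le> x $ j"
    show "c \<le> x $ i" using le[rule_format, of i] by simp
    then show "a $ j \<le> x $ j"
      using le[rule_format, of j] assms(1) by (cases "j = i") auto
  qed simp
  then show "cbox a b \<inter> {x. c \<le> x $ i} = cbox (set_coord a i c) b"
    unfolding set_eq_iff Int_iff mem_Collect_eq mem_box_cart by blast
qed

lemma hull_relaxation_lmeasurable:
  assumes "bounded B"
  shows "hull_relaxation B \<in> lmeasurable"
proof -
  let ?p = "\<lambda>x::real^3. point4 (x$1 * x$2 * x$3) x"
  have p: "?p = (\<lambda>x. (\<lambda>(f, x). point4 f x) (x$1 * x$2 * x$3, x))"
    by simp
  have "continuous_on (closure B) ?p"
    unfolding p
    by (intro continuous_on_compose2[OF linear_continuous_on[OF linear_point4[unfolded linear_conv_bounded_linear], of UNIV]]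
        continuous_intros) auto
  then have "bounded (?p ` B)"
    by (meson assms bounded_subset closure_subset compact_closure compact_continuous_image
        compact_imp_bounded image_mono)
  then show ?thesis
    unfolding hull_relaxation_point4
    by (intro measurable_convex convex_convex_hull bounded_convex_hull)
qed

text \<open>The relaxations of the two children lie in the relaxation of the parent, on different sides of
  the hyperplane \<open>x\<^sub>i = c\<close>, so they overlap in a null set.\<close>

lemma total_volume_le:
  assumes "i \<in> {2, 3 :: 3}"
  shows "total_volume a b i c \<le> measure lebesgue (hull_relaxation (cbox a b))"
proof -
  let ?L = "hull_relaxation (cbox a b \<inter> {x. x $ i \<le> c})"
  let ?U = "hull_relaxation (cbox a b \<inter> {x. x $ i \<ge> c})"
  \<comment> \<open>The position of \<open>x\<^sub>i\<close> in \<open>(f, x\<^sub>1, x\<^sub>2, x\<^sub>3)\<close>.\<close>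
  define k :: 4 where "k = (if i = 2 then 3 else 4)"
  have k: "point4 f x $ k = x $ i" for f x
    using assms by (auto simp: k_def)
  have meas: "?L \<in> lmeasurable" "?U \<in> lmeasurable" "hull_relaxation (cbox a b) \<in> lmeasurable"
    by (auto intro!: hull_relaxation_lmeasurable bounded_Int)
  have halfspace: "convex {v::real^4. v $ k \<le> c}" "convex {v::real^4. v $ k \<ge> c}"
    using convex_halfspace_le[of "axis k 1" c] convex_halfspace_ge[of c "axis k 1"]
    by (simp_all only: cart_eq_inner_axis inner_commute[of _ "axis k 1"])
  have "?L \<subseteq> {v. v $ k \<le> c}"
    unfolding hull_relaxation_point4
    by (rule hull_minimal) (use halfspace in \<open>auto simp: k\<close>)
  moreover have "?U \<subseteq> {v. v $ k \<ge> c}"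
    unfolding hull_relaxation_point4
    by (rule hull_minimal) (use halfspace in \<open>auto simp: k\<close>)
  ultimately have "?L \<inter> ?U \<subseteq> {v. v $ k = c}"
    by (auto intro: antisym)
  moreover have "negligible {v::real^4. v $ k = c}"
    using negligible_standard_hyperplane[of "axis k (1::real)" c] by (simp add: cart_eq_inner_axis)
  ultimately have "negligible (?L \<inter> ?U)"
    by (rule negligible_subset[rotated])
  then have "total_volume a b i c = measure lebesgue (?L \<union> ?U)"
    unfolding total_volume_def measure_Un3[OF meas(1,2)] by (simp only: negligible_imp_measure0 diff_0_right)
  also have "\<dots> \<le> measure lebesgue (hull_relaxation (cbox a b))"
  proof (rule measure_mono_fmeasurable)
    show "?L \<union> ?U \<subseteq> hull_relaxation (cbox a b)"
      unfolding hull_relaxation_point4 by (intro Un_least hull_mono image_mono) auto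
  qed (use meas in auto)
  finally show ?thesis .
qed

theorem theorem6:
  fixes a b :: "real^3" and i :: 3
  assumes "Omega a b" and "i \<in> {2, 3}"
  shows "is_arg_min (total_volume a b i) (\<lambda>c. c \<in> {a $ i .. b $ i}) ((a $ i + b $ i) / 2)"
proof -
  obtain P Q where vol: "\<And>l u. a $ i \<le> l \<Longrightarrow> l \<le> u \<Longrightarrow> u \<le> b $ i \<Longrightarrow>
    measure lebesgue (hull_relaxation (cbox (set_coord a i l) (set_coord b i u))) = (u - l) * (Q * l + P * u)"
    using measure_hull_relaxation_slab[OF assms] by blast
  define m where "m = (a $ i + b $ i) / 2"
  have ab: "a $ i < b $ i"
    using assms(1) by (simp add: Omega_def)
  then have m: "a $ i \<le> m" "m \<le> b $ i"
    by (auto simp: m_def)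
  have total: "total_volume a b i c = (b $ i - a $ i) * (Q * a $ i + P * b $ i) + (P - Q) * ((c - a $ i) * (c - b $ i))"
    if "a $ i \<le> c" "c \<le> b $ i" for c
    using vol[of "a $ i" c] vol[of c "b $ i"] that
    unfolding total_volume_def cbox_cut[OF that] by (simp add: algebra_simps)
  \<comment> \<open>The sign of \<open>P - Q\<close> comes from comparing children and parent at a single interior point.\<close>
  have "total_volume a b i m \<le> (b $ i - a $ i) * (Q * a $ i + P * b $ i)"
    using total_volume_le[OF assms(2), of a b m] vol[of "a $ i" "b $ i"] ab by simp
  then have "(P - Q) * ((m - a $ i) * (m - b $ i)) \<le> 0"
    using total[OF m] by simp
  moreover have "(m - a $ i) * (m - b $ i) < 0"
    using ab by (intro mult_pos_neg) (auto simp: m_def)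
  ultimately have PQ: "0 \<le> P - Q"
    by (simp add: mult_le_0_iff)
  have "total_volume a b i c = total_volume a b i m + (P - Q) * (c - m)\<^sup>2"
    if "a $ i \<le> c" "c \<le> b $ i" for c
  proof -
    have "(c - a $ i) * (c - b $ i) = (m - a $ i) * (m - b $ i) + (c - m)\<^sup>2"
      by (simp add: m_def field_simps power2_eq_square)
    then show ?thesis
      unfolding total[OF that] total[OF m] by (simp add: distrib_left)
  qed
  then have "total_volume a b i m \<le> total_volume a b i c" if "c \<in> {a $ i .. b $ i}" for c
    using PQ that by simp
  then show ?thesis
    unfolding is_arg_min_def m_def[symmetric] using m by (meson atLeastAtMost_iff not_less)
qed

end
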